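(* Let $F:\mathbb{R}^n\to\mathbb{R}$ be a convex differentiable function admitting a unique minimizer, and let $F^*=\min F$. Let $\alpha>0$, $t_0>0$ and $(x_0,v_0)\in\mathbb{R}^n\times\mathbb{R}^n$, let $g:[t_0,+\infty)\to\mathbb{R}^n$ be integrable, and let $x(\cdot)$ be any solution on $[t_0,+\infty)$ of $$\ddot x(t)+\frac{\alpha}{t}\dot x(t)+\nabla F(x(t))=g(t)$$ with $(x(t_0),\dot x(t_0))=(x_0,v_0)$. Let $1\le\gamma\le 2$ and assume that $$\int_{t_0}^{+\infty}t^{\frac{\gamma\alpha}{\gamma+2}}\|g(t)\|\,dt<+\infty .$$ If $F$ satisfies $\mathbf{H}_1(\gamma)$ and $\mathbf{H}_2(2)$, and if $\alpha>1+\frac{2}{\gamma}$, then, as $t\to+\infty$, $$F(x(t))-F^*=O\!\left(t^{-\frac{2\gamma\alpha}{\gamma+2}}\right).$$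
   Context: $\mathbb{R}^n$ carries the Euclidean scalar product $\langle\cdot,\cdot\rangle$ and norm $\|\cdot\|$; $B(x^*,\rho)$ is the open ball of center $x^*$ and radius $\rho$; $X^*=\operatorname{argmin}F$; $d(x,X^* )$ is the distance from $x$ to $X^*$; $F^*=\inf F$. Condition $\mathbf{H}_1(\gamma)$ ($\gamma\ge1$): for any minimizer $x^*\in X^*$ there exists $\eta>0$ such that for all $x\in B(x^*,\eta)$, $F(x)-F^*\le\frac1\gamma\langle\nabla F(x),x-x^*\rangle$. Condition $\mathbf{H}_2(r)$ ($r\ge1$): for any minimizer $x^*\in X^*$ there exist $K_r>0$ and $\epsilon>0$ such that for all $x\in B(x^*,\epsilon)$, $K_r\,d(x,X^* )^r\le F(x)-F^*$. Standing assumption: for any initial conditions $(x_0,v_0)\in\mathbb{R}^n\times\mathbb{R}^n$, the Cauchy problem for the differential equation has a unique global solution on $[t_0,+\infty)$ with $(x(t_0),\dot x(t_0))=(x_0,v_0)$. *)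

theory Defs
  imports "HOL-Analysis.Analysis" "HOL-Library.Landau_Symbols"
begin

definition gradient :: "('a::real_inner \<Rightarrow> real) \<Rightarrow> 'a \<Rightarrow> 'a" where
  "gradient F x = (THE D. GDERIV F x :> D)"

lemma GDERIV_gradient:
  fixes F :: "'a::euclidean_space \<Rightarrow> real"
  assumes "F differentiable (at x)"
  shows "GDERIV F x :> gradient F x"
proof -
  obtain F' where F': "(F has_derivative F') (at x)"
    using assms by (auto simp: differentiable_def)
  have "F' h = inner h (adjoint F' 1)" for h
    using adjoint_works[OF has_derivative_linear[OF F'], of h 1] by simp
  then have "F' = (\<lambda>h. inner h (adjoint F' 1))" by auto
  with F' have ex: "GDERIV F x :> adjoint F' 1"
    by (simp add: gderiv_def)
  have "D = E" if "GDERIV F x :> D" "GDERIV F x :> E" for D E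
  proof -
    have "(\<lambda>h. inner h D) = (\<lambda>h. inner h E)"
      using that unfolding gderiv_def by (rule has_derivative_unique)
    then show ?thesis by (metis inner_commute vector_eq_rdot)
  qed
  with ex have "\<exists>!D. GDERIV F x :> D" by blast
  then show ?thesis unfolding gradient_def by (rule theI')
qed

definition minimizers :: "('a \<Rightarrow> real) \<Rightarrow> 'a set" where
  "minimizers F = {x. is_arg_min F (\<lambda>_. True) x}"

definition minval :: "('a \<Rightarrow> real) \<Rightarrow> real" where
  "minval F = (INF x. F x)"

definition cond_H1 :: "real \<Rightarrow> ('a::euclidean_space \<Rightarrow> real) \<Rightarrow> bool" where
  "cond_H1 \<gamma> F \<longleftrightarrow>
     (\<forall>xs \<in> minimizers F. \<exists>\<eta>>0. \<forall>x \<in> ball xs \<eta>.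
        F x - minval F \<le> 1 / \<gamma> * inner (gradient F x) (x - xs))"

definition cond_H2 :: "real \<Rightarrow> ('a::euclidean_space \<Rightarrow> real) \<Rightarrow> bool" where
  "cond_H2 r F \<longleftrightarrow>
     (\<forall>xs \<in> minimizers F. \<exists>K>0. \<exists>\<epsilon>>0. \<forall>x \<in> ball xs \<epsilon>.
        K * infdist x (minimizers F) powr r \<le> F x - minval F)"

text \<open>Since the source term \<open>g\<close> is merely integrable, a solution is understood in the
  Caratheodory sense: \<open>x\<close> is differentiable on \<open>[t0, \<infinity>)\<close>, its derivative \<open>v\<close> is locally
  absolutely continuous, i.e. the indefinite integral of a locally integrable second derivative
  \<open>a\<close>, and the equation holds for almost every \<open>t\<close>. Only the values of \<open>x\<close> and \<open>g\<close>
  on \<open>[t0, \<infinity>)\<close> are relevant.\<close>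

definition is_solution ::
  "('a::euclidean_space \<Rightarrow> real) \<Rightarrow> real \<Rightarrow> real \<Rightarrow> (real \<Rightarrow> 'a) \<Rightarrow> 'a \<Rightarrow> 'a \<Rightarrow> (real \<Rightarrow> 'a) \<Rightarrow> bool"
where
  "is_solution F \<alpha> t0 g x0 v0 x \<longleftrightarrow>
     (\<exists>v a. x t0 = x0 \<and> v t0 = v0 \<and>
        (\<forall>t\<ge>t0. (x has_vector_derivative v t) (at t within {t0..})) \<and>
        (\<forall>t\<ge>t0. a absolutely_integrable_on {t0..t} \<and> v t = v t0 + integral {t0..t} a) \<and>
        (AE t in lebesgue. t \<ge> t0 \<longrightarrow>
           a t + (\<alpha> / t) *\<^sub>R v t + gradient F (x t) = g t))"

definition cauchy_well_posed ::
  "('a::euclidean_space \<Rightarrow> real) \<Rightarrow> real \<Rightarrow> real \<Rightarrow> (real \<Rightarrow> 'a) \<Rightarrow> bool"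
where
  "cauchy_well_posed F \<alpha> t0 g \<longleftrightarrow>
     (\<forall>x0 v0. (\<exists>x. is_solution F \<alpha> t0 g x0 v0 x) \<and>
        (\<forall>x y. is_solution F \<alpha> t0 g x0 v0 x \<longrightarrow> is_solution F \<alpha> t0 g x0 v0 y \<longrightarrow>
           (\<forall>t\<ge>t0. x t = y t)))"

end

theory Submission
  imports Defs
begin

text \<open>Let \<open>z\<close> be the minimizer, \<open>u = l (x - z) + t x'\<close> and
  \<open>E = t\<^sup>2 (F x - F z) + \<parallel>u\<parallel>\<^sup>2 / 2 + l (l + 1 - \<alpha>) \<parallel>x - z\<parallel>\<^sup>2 / 2\<close>. For \<open>l = 2 \<alpha> / (\<gamma> + 2)\<close> and
  \<open>p = l \<gamma> - 2\<close> the derivative of \<open>H = t powr p * E\<close> is bounded, as soon as \<open>H\<^sub>1(\<gamma>)\<close> applies, by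
  a multiple of \<open>t powr (p - 1) * \<parallel>x - z\<parallel>\<^sup>2\<close> plus the source term. As \<open>l (l + 1 - \<alpha>) < 0\<close>, the energy
  is not obviously positive, but \<open>H\<^sub>2(2)\<close> bounds \<open>\<parallel>x - z\<parallel>\<^sup>2\<close> by a multiple of \<open>F x - F z\<close>, so that for
  large \<open>t\<close> the first two terms of \<open>E\<close> dominate and the derivative of \<open>H\<close> is at most
  \<open>C * t powr (-3) * H\<close> plus an integrable function times \<open>sqrt H\<close>. Hence \<open>H\<close> is bounded.
  Both conditions being local, one first needs \<open>x(t)\<close> to
  converge to \<open>z\<close>, which the same computation with \<open>l = \<alpha> - 1\<close> and \<open>p = min 0 (\<alpha> - 3)\<close> provides
  from convexity alone.

  As the source is merely integrable, the energy is only absolutely continuous; it is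
  differentiated through a product rule for indefinite integrals.\<close>

section \<open>Indefinite integrals of absolutely integrable functions\<close>

text \<open>Absolute continuity in integral form: \<open>f'\<close> stands for an almost-everywhere
  derivative and may be merely integrable. For \<open>B < A\<close> the predicate holds trivially,
  so later facts can range over every right end \<open>T\<close>.\<close>

definition primitive_on ::
  "real \<Rightarrow> real \<Rightarrow> (real \<Rightarrow> 'a::euclidean_space) \<Rightarrow> (real \<Rightarrow> 'a) \<Rightarrow> bool" where
  "primitive_on A B f f' \<longleftrightarrow> f' absolutely_integrable_on {A..B} \<and>
     (\<forall>s t. A \<le> s \<longrightarrow> s \<le> t \<longrightarrow> t \<le> B \<longrightarrow> (f' has_integral (f t - f s)) {s..t})"

lemma primitive_onD:
  assumes "primitive_on A B f f'"
  shows "f' absolutely_integrable_on {A..B}"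
    and "A \<le> s \<Longrightarrow> s \<le> t \<Longrightarrow> t \<le> B \<Longrightarrow> (f' has_integral (f t - f s)) {s..t}"
  using assms unfolding primitive_on_def by auto

lemma primitive_on_continuous:
  assumes "primitive_on A B f f'"
  shows "continuous_on {A..B} f"
proof -
  have "continuous_on {A..B} (\<lambda>t. f A + integral {A..t} f')"
    using primitive_onD(1)[OF assms]
    by (intro continuous_intros indefinite_integral_continuous_1)
      (simp add: absolutely_integrable_on_def)
  then show ?thesis
    by (rule continuous_on_eq) (use primitive_onD(2)[OF assms, of A] in \<open>force dest: integral_unique\<close>)
qed

text \<open>The fundamental theorem for the gauge integral accepts any derivative that exists at
  every point. Absolute integrability is a separate assumption because a derivative may be only
  conditionally integrable.\<close>

lemma primitive_on_derivative:
  assumes "f' absolutely_integrable_on {A..B}"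
    and "\<And>t. A \<le> t \<Longrightarrow> t \<le> B \<Longrightarrow> (f has_vector_derivative f' t) (at t within {A..B})"
  shows "primitive_on A B f f'"
  unfolding primitive_on_def
proof (intro conjI allI impI assms(1))
  fix s t assume "A \<le> s" "s \<le> t" "t \<le> B"
  then show "(f' has_integral (f t - f s)) {s..t}"
    by (intro fundamental_theorem_of_calculus)
      (auto intro!: has_vector_derivative_within_subset[OF assms(2)])
qed

lemma primitive_on_bounded_linear:
  fixes h :: "'a::euclidean_space \<Rightarrow> 'b::euclidean_space"
  assumes "bounded_linear h" "primitive_on A B f f'"
  shows "primitive_on A B (\<lambda>t. h (f t)) (\<lambda>t. h (f' t))"
  using absolutely_integrable_linear[OF primitive_onD(1)[OF assms(2)] assms(1)]
    has_integral_linear[OF primitive_onD(2)[OF assms(2)] assms(1)]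
  by (auto simp: primitive_on_def o_def linear_diff[OF bounded_linear.linear[OF assms(1)]])

lemma primitive_on_add:
  assumes "primitive_on A B f f'" "primitive_on A B g g'"
  shows "primitive_on A B (\<lambda>t. f t + g t) (\<lambda>t. f' t + g' t)"
  unfolding primitive_on_def
proof (intro conjI allI impI)
  show "(\<lambda>t. f' t + g' t) absolutely_integrable_on {A..B}"
    using assms by (auto intro: set_integral_add(1) simp: primitive_on_def)
  fix s t assume "A \<le> s" "s \<le> t" "t \<le> B"
  from has_integral_add[OF primitive_onD(2)[OF assms(1) this] primitive_onD(2)[OF assms(2) this]]
  show "((\<lambda>t. f' t + g' t) has_integral f t + g t - (f s + g s)) {s..t}"
    by (simp add: algebra_simps)
qed

lemma primitive_on_diff_const:
  assumes "primitive_on A B f f'"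
  shows "primitive_on A B (\<lambda>t. f t - c) f'"
  using assms by (simp add: primitive_on_def)

lemma absolutely_integrable_bilinear_continuous:
  fixes prod :: "'a::euclidean_space \<Rightarrow> 'b::euclidean_space \<Rightarrow> 'c::euclidean_space"
  assumes "bounded_bilinear prod" "continuous_on {A..B::real} f" "g absolutely_integrable_on {A..B}"
  shows "(\<lambda>t. prod (f t) (g t)) absolutely_integrable_on {A..B}"
proof (rule absolutely_integrable_bounded_measurable_product[where h = prod])
  show "bilinear prod" using assms(1) by (simp add: bilinear_conv_bounded_bilinear)
  show "f \<in> borel_measurable (lebesgue_on {A..B})"
    using assms(2) by (intro continuous_imp_measurable_on_sets_lebesgue) auto
  show "bounded (f ` {A..B})"
    using assms(2) by (intro compact_imp_bounded compact_continuous_image) auto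
qed (use assms in auto)

text \<open>On a short interval around \<open>r\<close> both factors are nearly constant, so the error made by
  the product rule is at most \<open>e\<close> times the integral of \<open>norm f' + norm g'\<close>; these bounds are
  additive and hence survive the gluing of intervals.\<close>

lemma primitive_on_bilinear:
  fixes prod :: "'a::euclidean_space \<Rightarrow> 'b::euclidean_space \<Rightarrow> 'c::euclidean_space"
  assumes bil: "bounded_bilinear prod"
    and f: "primitive_on A B f f'" and g: "primitive_on A B g g'"
  shows "primitive_on A B (\<lambda>t. prod (f t) (g t)) (\<lambda>t. prod (f t) (g' t) + prod (f' t) (g t))"
proof -
  interpret bounded_bilinear prod by (rule bil)
  define D where "D t = prod (f t) (g' t) + prod (f' t) (g t)" for t
  define m where "m t = norm (f' t) + norm (g' t)" for t
  note cf = primitive_on_continuous[OF f] and cg = primitive_on_continuous[OF g]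
  have D: "D absolutely_integrable_on {A..B}"
    unfolding D_def
    using absolutely_integrable_bilinear_continuous[OF bil cf primitive_onD(1)[OF g]]
      absolutely_integrable_bilinear_continuous[OF bounded_bilinear.flip[OF bil] cg primitive_onD(1)[OF f]]
    by (rule set_integral_add(1))
  have m: "m absolutely_integrable_on {A..B}"
    unfolding m_def using primitive_onD(1)[OF f] primitive_onD(1)[OF g]
    by (intro set_integral_add(1) absolutely_integrable_norm[unfolded o_def])
  obtain K where K: "K > 0" "\<And>a b. norm (prod a b) \<le> norm a * norm b * K"
    using pos_bounded by auto
  have Dint: "D integrable_on {s..t}" if "A \<le> s" "t \<le> B" for s t
    using D that by (meson absolutely_integrable_on_def atLeastatMost_subset_iff integrable_on_subinterval)
  have mint: "m integrable_on {s..t}" if "A \<le> s" "t \<le> B" for s t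
    using m that by (meson absolutely_integrable_on_def atLeastatMost_subset_iff integrable_on_subinterval)
  define err where "err s t = prod (f t) (g t) - prod (f s) (g s) - integral {s..t} D" for s t
  have err_le: "norm (err s t) \<le> e * integral {s..t} m"
    if st: "A \<le> s" "s \<le> t" "t \<le> B" and e: "e > 0" for s t e
  proof -
    have "A \<le> s \<and> t \<le> B \<longrightarrow> norm (err s t) \<le> e * integral {s..t} m"
      using st(2)
    proof (induction rule: Bolzano)
      case (trans a b c)
      show ?case
      proof
        assume abc: "A \<le> a \<and> c \<le> B"
        have *: "integral {a..b} D + integral {b..c} D = integral {a..c} D"
          "integral {a..b} m + integral {b..c} m = integral {a..c} m"
          using trans abc Dint mint by (auto intro!: Henstock_Kurzweil_Integration.integral_combine)
        have "err a c = err a b + err b c"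
          by (simp add: err_def *(1)[symmetric])
        then have "norm (err a c) \<le> norm (err a b) + norm (err b c)"
          by (simp add: norm_triangle_ineq)
        also have "\<dots> \<le> e * integral {a..b} m + e * integral {b..c} m"
          using trans abc by (intro add_mono) auto
        also have "\<dots> = e * integral {a..c} m"
          using *(2) by (simp add: algebra_simps flip: *(2))
        finally show "norm (err a c) \<le> e * integral {a..c} m" .
      qed
    next
      case (local r)
      then have r: "r \<in> {A..B}" using st by auto
      \<comment> \<open>Comparing two values through \<open>r\<close> costs \<open>2 * e'\<close>
        and \<open>prod\<close> costs a factor \<open>K\<close>; with this choice the total is
        exactly \<open>e * m x\<close>.\<close>
      define e' where "e' = e / (2 * K)"
      have e': "e' > 0" using e K by (simp add: e'_def)
      obtain d1 where d1: "d1 > 0" "\<And>x. x \<in> {A..B} \<Longrightarrow> dist x r < d1 \<Longrightarrow> dist (f x) (f r) < e'"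
        using cf r e' unfolding continuous_on_iff by metis
      obtain d2 where d2: "d2 > 0" "\<And>x. x \<in> {A..B} \<Longrightarrow> dist x r < d2 \<Longrightarrow> dist (g x) (g r) < e'"
        using cg r e' unfolding continuous_on_iff by metis
      show ?case
      proof (intro exI[of _ "min d1 d2"] conjI allI impI)
        fix a b assume "a \<le> r \<and> r \<le> b \<and> b - a < min d1 d2" and "A \<le> a \<and> b \<le> B"
        then have ab: "a \<le> r" "r \<le> b" "b - a < d1" "b - a < d2" "A \<le> a" "b \<le> B" "a \<le> b" by auto
        have cl: "norm (f a - f x) \<le> 2 * e'" "norm (g b - g x) \<le> 2 * e'" if "x \<in> {a..b}" for x
        proof -
          have "dist (f a) (f r) < e'" "dist (f x) (f r) < e'"
            using that ab by (auto intro!: d1(2) simp: dist_real_def)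
          then show "norm (f a - f x) \<le> 2 * e'"
            using dist_triangle2[of "f a" "f x" "f r"] by (simp add: dist_norm)
          have "dist (g b) (g r) < e'" "dist (g x) (g r) < e'"
            using that ab by (auto intro!: d2(2) simp: dist_real_def)
          then show "norm (g b - g x) \<le> 2 * e'"
            using dist_triangle2[of "g b" "g x" "g r"] by (simp add: dist_norm)
        qed
        have i1: "((\<lambda>x. prod (f' x) (g b)) has_integral prod (f b - f a) (g b)) {a..b}"
          using has_integral_linear[OF primitive_onD(2)[OF f ab(5,7,6)] bounded_linear_left]
          by (simp add: o_def)
        have i2: "((\<lambda>x. prod (f a) (g' x)) has_integral prod (f a) (g b - g a)) {a..b}"
          using has_integral_linear[OF primitive_onD(2)[OF g ab(5,7,6)] bounded_linear_right]
          by (simp add: o_def)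
        \<comment> \<open>With \<open>g\<close> frozen at \<open>b\<close> and \<open>f\<close> at
          \<open>a\<close>, the two integrals add up exactly to the increment of
          \<open>prod (f t) (g t)\<close>, so \<open>err a b\<close> is the integral of a pointwise
          small function.\<close>
        have "((\<lambda>x. prod (f' x) (g b) + prod (f a) (g' x) - D x) has_integral
            prod (f b - f a) (g b) + prod (f a) (g b - g a) - integral {a..b} D) {a..b}"
          using Dint ab by (intro has_integral_diff has_integral_add i1 i2 integrable_integral) auto
        also have "prod (f b - f a) (g b) + prod (f a) (g b - g a) - integral {a..b} D = err a b"
          by (simp add: err_def diff_left diff_right)
        finally have "((\<lambda>x. prod (f' x) (g b) + prod (f a) (g' x) - D x) has_integral err a b) {a..b}" .
        moreover have "((\<lambda>x. e * m x) has_integral e * integral {a..b} m) {a..b}"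
          using mint ab by (intro has_integral_mult_right integrable_integral) auto
        moreover have "norm (prod (f' x) (g b) + prod (f a) (g' x) - D x) \<le> e * m x"
          if "x \<in> {a..b}" for x
        proof -
          have "norm (prod (f' x) (g b) + prod (f a) (g' x) - D x)
              = norm (prod (f' x) (g b - g x) + prod (f a - f x) (g' x))"
            by (simp add: D_def diff_left diff_right algebra_simps)
          also have "\<dots> \<le> norm (f' x) * norm (g b - g x) * K + norm (f a - f x) * norm (g' x) * K"
            by (intro norm_triangle_mono K)
          also have "\<dots> \<le> norm (f' x) * (2 * e') * K + (2 * e') * norm (g' x) * K"
            using cl[OF that] K by (intro add_mono mult_right_mono mult_left_mono) auto
          also have "\<dots> = e * m x"
            using K by (simp add: e'_def m_def field_simps)
          finally show ?thesis .
        qed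
        ultimately show "norm (err a b) \<le> e * integral {a..b} m"
          by (metis (no_types, lifting) integral_norm_bound_integral has_integral_integrable integral_unique)
      qed (use d1 d2 in auto)
    qed
    with st show ?thesis by blast
  qed
  have "err s t = 0" if st: "A \<le> s" "s \<le> t" "t \<le> B" for s t
  proof -
    define M where "M = integral {s..t} m"
    have M: "0 \<le> M"
      using mint st unfolding M_def by (intro integral_nonneg) (auto simp: m_def)
    have "norm (err s t) \<le> 0 + e" if "e > 0" for e
    proof -
      \<comment> \<open>Adding 1 keeps the denominator positive when \<open>M = 0\<close>.\<close>
      have "norm (err s t) \<le> e / (M + 1) * M"
        using err_le[OF st, of "e / (M + 1)"] M that by (simp add: M_def)
      also have "\<dots> \<le> e" using M that by (simp add: field_simps)
      finally show ?thesis by simp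
    qed
    then show ?thesis using field_le_epsilon[of "norm (err s t)" 0] by simp
  qed
  then show ?thesis
    unfolding primitive_on_def D_def[symmetric]
    using D Dint by (auto simp: err_def intro!: integrable_integral has_integral_eq_rhs[OF integrable_integral])
qed

lemma primitive_on_cong:
  assumes "primitive_on A B f f'"
    and "\<And>t. A \<le> t \<Longrightarrow> t \<le> B \<Longrightarrow> f t = h t" "\<And>t. A \<le> t \<Longrightarrow> t \<le> B \<Longrightarrow> f' t = h' t"
  shows "primitive_on A B h h'"
  unfolding primitive_on_def
proof (intro conjI allI impI)
  have "f' absolutely_integrable_on {A..B} \<longleftrightarrow> h' absolutely_integrable_on {A..B}"
    using assms(3) by (intro set_integrable_cong) auto
  then show "h' absolutely_integrable_on {A..B}" using primitive_onD(1)[OF assms(1)] by blast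
  fix s t assume st: "A \<le> s" "s \<le> t" "t \<le> B"
  have "(f' has_integral (h t - h s)) {s..t}"
    using primitive_onD(2)[OF assms(1) st] assms(2)[of s] assms(2)[of t] st by simp
  then show "(h' has_integral (h t - h s)) {s..t}"
    by (rule has_integral_eq[rotated]) (use st assms(3) in auto)
qed

lemma primitive_on_continuous_derivative:
  assumes "continuous_on {A..B} f'"
    and "\<And>t. A \<le> t \<Longrightarrow> t \<le> B \<Longrightarrow> (f has_vector_derivative f' t) (at t within {A..B})"
  shows "primitive_on A B f f'"
  using assms by (intro primitive_on_derivative absolutely_integrable_continuous_real)

lemma primitive_on_powr:
  assumes "0 < A"
  shows "primitive_on A B (\<lambda>t. t powr q) (\<lambda>t. q * t powr (q - 1))"
  using assms
  by (intro primitive_on_continuous_derivative continuous_intros)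
    (auto intro!: has_real_derivative_powr[THEN has_field_derivative_at_within]
      simp flip: has_real_derivative_iff_has_vector_derivative)

section \<open>Convex functions\<close>

text \<open>Reduction to one variable: restricted to the line through \<open>x\<close> and
  \<open>y\<close>, \<open>F\<close> stays convex and lies above its tangent at the parameter
  0.\<close>

lemma convex_on_gradient_le:
  fixes F :: "'a::euclidean_space \<Rightarrow> real"
  assumes cvx: "convex_on UNIV F" and "F differentiable (at x)"
  shows "F x - F y \<le> inner (gradient F x) (x - y)"
proof -
  define \<phi> where "\<phi> s = F (x + s *\<^sub>R (y - x))" for s
  have "convex_on UNIV \<phi>"
  proof (rule convex_onI)
    fix t a b :: real assume "0 < t" "t < 1"
    have "x + ((1 - t) *\<^sub>R a + t *\<^sub>R b) *\<^sub>R (y - x)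
        = (1 - t) *\<^sub>R (x + a *\<^sub>R (y - x)) + t *\<^sub>R (x + b *\<^sub>R (y - x))"
      by (simp add: algebra_simps)
    then show "\<phi> ((1 - t) *\<^sub>R a + t *\<^sub>R b) \<le> (1 - t) * \<phi> a + t * \<phi> b"
      using convex_onD[OF cvx, of t] \<open>0 < t\<close> \<open>t < 1\<close> by (simp add: \<phi>_def)
  qed auto
  moreover have "(\<phi> has_field_derivative inner (y - x) (gradient F x)) (at 0)"
  proof -
    have "((\<lambda>s. x + s *\<^sub>R (y - x)) has_derivative (\<lambda>s. s *\<^sub>R (y - x))) (at 0)"
      by (auto intro!: derivative_eq_intros)
    moreover have "(F has_derivative (\<lambda>h. inner h (gradient F x))) (at (x + 0 *\<^sub>R (y - x)))"
      using GDERIV_gradient[OF assms(2)] by (simp add: gderiv_def)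
    ultimately show ?thesis
      unfolding \<phi>_def has_field_derivative_def
      by (rule has_derivative_compose[THEN has_derivative_eq_rhs]) (simp add: fun_eq_iff mult.commute)
  qed
  ultimately have "inner (y - x) (gradient F x) * (1 - 0) \<le> \<phi> 1 - \<phi> 0"
    by (intro convex_on_imp_above_tangent[of UNIV]) auto
  then show ?thesis
    by (simp add: \<phi>_def inner_commute inner_diff_right)
qed

text \<open>By compactness \<open>F\<close> has a least value on the sphere of radius \<delta>,
  strictly above \<open>F z\<close>. The segment from \<open>z\<close> to a point outside the ball
  crosses the sphere, so convexity carries this lower bound to the whole exterior.\<close>

lemma convex_on_near_unique_minimizer:
  fixes F :: "'a::euclidean_space \<Rightarrow> real"
  assumes cvx: "convex_on UNIV F" and min: "\<And>y. y \<noteq> z \<Longrightarrow> F z < F y" and "0 < \<delta>"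
  shows "\<exists>m>0. \<forall>y. F y - F z < m \<longrightarrow> dist z y < \<delta>"
\<comment> \<open>With an empty sphere no point can lie outside the ball, since it would project
  radially onto the sphere.\<close>
proof (cases "sphere z \<delta> = {}")
  case True
  have "dist z y < \<delta>" for y
  proof (rule ccontr)
    assume "\<not> dist z y < \<delta>"
    then have "z + (\<delta> / norm (y - z)) *\<^sub>R (y - z) \<in> sphere z \<delta>"
      using \<open>0 < \<delta>\<close> by (auto simp: dist_norm)
    with True show False by blast
  qed
  then show ?thesis by (intro exI[of _ 1]) auto
next
  case False
  have "continuous_on (sphere z \<delta>) F"
    using convex_on_continuous[OF open_UNIV cvx] by (rule continuous_on_subset) auto
  then obtain s where s: "s \<in> sphere z \<delta>" "\<And>y. y \<in> sphere z \<delta> \<Longrightarrow> F s \<le> F y"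
    using continuous_attains_inf[of "sphere z \<delta>" F] False by auto
  have "F s \<le> F y" if y: "\<delta> \<le> dist z y" for y
  proof -
    define \<theta> where "\<theta> = \<delta> / dist z y"
    have \<theta>: "0 \<le> \<theta>" "\<theta> \<le> 1" and "0 < dist z y"
      using y \<open>0 < \<delta>\<close> by (auto simp: \<theta>_def divide_le_eq_1)
    define q where "q = (1 - \<theta>) *\<^sub>R z + \<theta> *\<^sub>R y"
    have "z - q = \<theta> *\<^sub>R (z - y)" by (simp add: q_def algebra_simps)
    then have "dist z q = \<theta> * dist z y" using \<theta> by (simp add: dist_norm)
    then have "q \<in> sphere z \<delta>" using \<open>0 < dist z y\<close> by (simp add: \<theta>_def)
    then have "F s \<le> F q" by (rule s(2))
    also have "F q \<le> (1 - \<theta>) * F z + \<theta> * F y"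
      unfolding q_def using \<theta> by (intro convex_onD[OF cvx]) auto
    also have "\<dots> \<le> (1 - \<theta>) * F y + \<theta> * F y"
      using min[of y] \<theta> \<open>0 < dist z y\<close> by (intro add_right_mono mult_left_mono) fastforce+
    finally show ?thesis by (simp add: algebra_simps)
  qed
  moreover have "F z < F s" using s(1) \<open>0 < \<delta>\<close> by (intro min) auto
  ultimately show ?thesis
    by (intro exI[of _ "F s - F z"]) (force simp: not_less[symmetric])
qed

section \<open>The energy of a trajectory\<close>

text \<open>A Gronwall-type absorption: apply \<open>step\<close> at a maximum point
  \<open>r\<close> of \<open>h\<close> on \<open>{T..t}\<close> with \<open>S = h r\<close>. Young's
  inequality bounds the root term by \<open>h r / 4\<close> plus
  \<open>2 * \<kappa>\<^sup>2\<close>, so half of \<open>h r\<close> can be moved to the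
  left.\<close>

lemma bounded_by_sublinear_feedback:
  fixes h :: "real \<Rightarrow> real"
  assumes cont: "\<And>t. continuous_on {T..t} h" and nonneg: "\<And>t. T \<le> t \<Longrightarrow> 0 \<le> h t"
    and step: "\<And>t S. T \<le> t \<Longrightarrow> (\<And>r. T \<le> r \<Longrightarrow> r \<le> t \<Longrightarrow> h r \<le> S) \<Longrightarrow>
      h t \<le> h T + S / 4 + sqrt (2 * S) * \<kappa>"
  assumes "T \<le> t"
  shows "h t \<le> 2 * h T + 4 * \<kappa>\<^sup>2"
proof -
  obtain r where r: "r \<in> {T..t}" "\<And>s. s \<in> {T..t} \<Longrightarrow> h s \<le> h r"
    using continuous_attains_sup[of "{T..t}" h] cont \<open>T \<le> t\<close> by auto
  have "h r \<le> h T + h r / 4 + sqrt (2 * h r) * \<kappa>"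
    using r by (intro step) auto
  moreover have "sqrt (2 * h r) * \<kappa> \<le> h r / 4 + 2 * \<kappa>\<^sup>2"
  proof -
    have "(sqrt (2 * h r))\<^sup>2 = 2 * h r" using nonneg r by simp
    moreover have "0 \<le> (sqrt (2 * h r) - 4 * \<kappa>)\<^sup>2" by simp
    ultimately show ?thesis by (simp add: power2_diff power_mult_distrib)
  qed
  ultimately have "h r \<le> 2 * h T + 4 * \<kappa>\<^sup>2" by simp
  then show ?thesis using r(2)[of t] \<open>T \<le> t\<close> by simp
qed

text \<open>Here \<open>z\<close> is an arbitrary reference point. Minimality, convexity and the
  local conditions enter only through the inequalities assumed in
  \<open>energy_bounded\<close>.\<close>

locale damped_trajectory =
  fixes F :: "'a::euclidean_space \<Rightarrow> real" and \<alpha> t0 :: real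
    and g x v a :: "real \<Rightarrow> 'a" and z :: 'a
  assumes F_differentiable: "\<And>y. F differentiable (at y)"
    and t0: "0 < t0"
    and x_deriv: "\<And>t. t0 \<le> t \<Longrightarrow> (x has_vector_derivative v t) (at t within {t0..})"
    and v_primitive: "\<And>T. primitive_on t0 T v a"
    and ode: "\<And>t. t0 \<le> t \<Longrightarrow> a t + (\<alpha> / t) *\<^sub>R v t + gradient F (x t) = g t"
    and g_integrable: "g absolutely_integrable_on {t0..}"
begin

definition gap :: "real \<Rightarrow> real" where
  "gap t = F (x t) - F z"

definition mix :: "real \<Rightarrow> real \<Rightarrow> 'a" where
  "mix l t = l *\<^sub>R (x t - z) + t *\<^sub>R v t"

text \<open>This is \<open>H\<close> of the overview, with the factor \<open>t powr p\<close>
  distributed over the terms of \<open>E\<close>.\<close>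

definition energy :: "real \<Rightarrow> real \<Rightarrow> real \<Rightarrow> real" where
  "energy l p t = t powr (p + 2) * gap t + t powr p *
     (inner (mix l t) (mix l t) / 2 + l * (l + 1 - \<alpha>) / 2 * inner (x t - z) (x t - z))"

text \<open>The form reached by eliminating \<open>a t\<close> through the equation and writing
  \<open>t *\<^sub>R v t\<close> as \<open>mix l t\<close> minus
  \<open>l *\<^sub>R (x t - z)\<close>. The products of gradient and velocity cancel, and the weight
  \<open>l * (l + 1 - \<alpha>)\<close> is the one that cancels the products of
  \<open>mix l t\<close> with \<open>x t - z\<close>.\<close>

definition energy_deriv :: "real \<Rightarrow> real \<Rightarrow> real \<Rightarrow> real" where
  "energy_deriv l p t =
     t powr (p + 1) * ((p + 2) * gap t - l * inner (gradient F (x t)) (x t - z)) +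
     t powr (p - 1) * ((l + 1 - \<alpha> + p / 2) * inner (mix l t) (mix l t) +
       l * (l + 1 - \<alpha>) * (p / 2 - l) * inner (x t - z) (x t - z)) +
     t powr (p + 1) * inner (g t) (mix l t)"

lemma x_primitive: "primitive_on t0 T x v"
  using primitive_on_continuous[OF v_primitive]
  by (intro primitive_on_continuous_derivative)
    (auto intro: has_vector_derivative_within_subset[OF x_deriv])

text \<open>The gradient along the trajectory is integrable because the equation expresses it through
  \<open>g\<close>, \<open>a\<close> and \<open>v\<close>; continuity of the gradient is never needed.\<close>

lemma gap_primitive: "primitive_on t0 T gap (\<lambda>t. inner (v t) (gradient F (x t)))"
proof (rule primitive_on_derivative)
  note cv = primitive_on_continuous[OF v_primitive, of T]
  have "(\<lambda>t. (\<alpha> / t) *\<^sub>R v t) absolutely_integrable_on {t0..T}"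
    using t0 cv by (intro absolutely_integrable_continuous_real continuous_intros) auto
  moreover have "g absolutely_integrable_on {t0..T}"
    using g_integrable by (rule absolutely_integrable_on_subinterval) auto
  ultimately have "(\<lambda>t. g t - a t - (\<alpha> / t) *\<^sub>R v t) absolutely_integrable_on {t0..T}"
    using primitive_onD(1)[OF v_primitive, of T] by (intro set_integral_diff(1))
  then have "(\<lambda>t. inner (v t) (g t - a t - (\<alpha> / t) *\<^sub>R v t)) absolutely_integrable_on {t0..T}"
    by (rule absolutely_integrable_bilinear_continuous[OF bounded_bilinear_inner cv])
  moreover have "g t - a t - (\<alpha> / t) *\<^sub>R v t = gradient F (x t)" if "t0 \<le> t" for t
    using ode[OF that] by (simp add: algebra_simps)
  ultimately show "(\<lambda>t. inner (v t) (gradient F (x t))) absolutely_integrable_on {t0..T}"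
    by (subst (asm) set_integrable_cong) auto
  fix t assume "t0 \<le> t" "t \<le> T"
  then have x': "(x has_derivative (\<lambda>h. h *\<^sub>R v t)) (at t within {t0..T})"
    using x_deriv[of t] by (auto intro: has_derivative_subset simp: has_vector_derivative_def)
  have "(F has_derivative (\<lambda>h. inner h (gradient F (x t)))) (at (x t))"
    using GDERIV_gradient[OF F_differentiable] by (simp add: gderiv_def)
  from has_derivative_compose[OF x' this]
  show "(gap has_vector_derivative inner (v t) (gradient F (x t))) (at t within {t0..T})"
    unfolding gap_def has_vector_derivative_def by (auto intro!: derivative_eq_intros)
qed

lemma energy_primitive: "primitive_on t0 T (energy l p) (energy_deriv l p)"
proof (rule primitive_on_cong)
  note d = primitive_on_diff_const[OF x_primitive, of T z]
  have id: "primitive_on t0 T (\<lambda>t. t) (\<lambda>t. 1)"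
    by (intro primitive_on_continuous_derivative) (auto intro: derivative_eq_intros)
  note u = primitive_on_add[OF primitive_on_bounded_linear[OF bounded_linear_scaleR_right[of l] d]
      primitive_on_bilinear[OF bounded_bilinear_scaleR id v_primitive]]
  note uu = primitive_on_bounded_linear[OF bounded_linear_mult_right[of "1/2"]
      primitive_on_bilinear[OF bounded_bilinear_inner u u]]
  note dd = primitive_on_bounded_linear[OF bounded_linear_mult_right[of "l * (l + 1 - \<alpha>) / 2"]
      primitive_on_bilinear[OF bounded_bilinear_inner d d]]
  note pw = primitive_on_powr[OF t0]
  note total = primitive_on_add[OF
      primitive_on_bilinear[OF bounded_bilinear_mult pw[of T "p + 2"] gap_primitive]
      primitive_on_bilinear[OF bounded_bilinear_mult pw[of T p] primitive_on_add[OF uu dd]]]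
  show "primitive_on t0 T
     (\<lambda>t. t powr (p + 2) * gap t +
           t powr p * (1 / 2 * inner (l *\<^sub>R (x t - z) + t *\<^sub>R v t) (l *\<^sub>R (x t - z) + t *\<^sub>R v t) +
             l * (l + 1 - \<alpha>) / 2 * inner (x t - z) (x t - z)))
     (\<lambda>t. t powr (p + 2) * inner (v t) (gradient F (x t)) + (p + 2) * t powr (p + 2 - 1) * gap t +
           (t powr p * (1 / 2 * (
               inner (l *\<^sub>R (x t - z) + t *\<^sub>R v t) (l *\<^sub>R v t + (t *\<^sub>R a t + 1 *\<^sub>R v t)) +
               inner (l *\<^sub>R v t + (t *\<^sub>R a t + 1 *\<^sub>R v t)) (l *\<^sub>R (x t - z) + t *\<^sub>R v t)) +
             l * (l + 1 - \<alpha>) / 2 * (inner (x t - z) (v t) + inner (v t) (x t - z))) +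
           p * t powr (p - 1) * (1 / 2 *
               inner (l *\<^sub>R (x t - z) + t *\<^sub>R v t) (l *\<^sub>R (x t - z) + t *\<^sub>R v t) +
             l * (l + 1 - \<alpha>) / 2 * inner (x t - z) (x t - z))))"
    by (rule total)
next
  fix t assume t: "t0 \<le> t" "t \<le> T"
  then have "t > 0" using t0 by simp
  \<comment> \<open>Writing every power as a natural power of \<open>t\<close> times
    \<open>P\<close> turns the claim into a polynomial identity.\<close>
  define P where "P = t powr (p - 1)"
  have pow: "t powr (p - 1 + real n) = t ^ n * P" for n
    using \<open>t > 0\<close> by (simp only: powr_add powr_realpow P_def mult.commute)
  have P: "t powr p = t * P" "t powr (p + 1) = t\<^sup>2 * P" "t powr (p + 2) = t^3 * P"
      "t powr (p + 2 - 1) = t\<^sup>2 * P"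
    using pow[of 1] pow[of 2] pow[of 3] by (simp_all add: algebra_simps)
  show "t powr (p + 2) * gap t +
           t powr p * (1 / 2 * inner (l *\<^sub>R (x t - z) + t *\<^sub>R v t) (l *\<^sub>R (x t - z) + t *\<^sub>R v t) +
             l * (l + 1 - \<alpha>) / 2 * inner (x t - z) (x t - z)) = energy l p t"
    by (simp add: energy_def mix_def)
  define d where "d = x t - z"
  define n where "n = gradient F (x t)"
  have ta: "t *\<^sub>R a t = t *\<^sub>R g t - \<alpha> *\<^sub>R v t - t *\<^sub>R n"
    using \<open>t > 0\<close> by (simp add: ode[OF t(1), symmetric] n_def algebra_simps)
  note comm = inner_commute[of d "v t"] inner_commute[of d n] inner_commute[of "v t" n]
    inner_commute[of d "g t"] inner_commute[of "v t" "g t"]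
  show "t powr (p + 2) * inner (v t) (gradient F (x t)) + (p + 2) * t powr (p + 2 - 1) * gap t +
           (t powr p * (1 / 2 * (
               inner (l *\<^sub>R (x t - z) + t *\<^sub>R v t) (l *\<^sub>R v t + (t *\<^sub>R a t + 1 *\<^sub>R v t)) +
               inner (l *\<^sub>R v t + (t *\<^sub>R a t + 1 *\<^sub>R v t)) (l *\<^sub>R (x t - z) + t *\<^sub>R v t)) +
             l * (l + 1 - \<alpha>) / 2 * (inner (x t - z) (v t) + inner (v t) (x t - z))) +
           p * t powr (p - 1) * (1 / 2 *
               inner (l *\<^sub>R (x t - z) + t *\<^sub>R v t) (l *\<^sub>R (x t - z) + t *\<^sub>R v t) +
             l * (l + 1 - \<alpha>) / 2 * inner (x t - z) (x t - z))) = energy_deriv l p t"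
    unfolding energy_deriv_def mix_def d_def[symmetric] n_def[symmetric] P P_def[symmetric] ta
      inner_simps scaleR_one comm[symmetric]
    by (simp add: field_simps power2_eq_square power3_eq_cube)
qed

text \<open>The estimate shared by the crude and the sharp rate. \<open>grad\<close> and
  \<open>damp\<close> give two terms of the derivative a sign, \<open>dist\<close> bounds the third
  by the energy itself, and \<open>lower\<close> bounds the source term by the root of the energy
  times \<open>k\<close>. The condition on \<open>T\<close> keeps the linear feedback small enough
  to be absorbed.\<close>

lemma energy_bounded:
  assumes T: "t0 \<le> T" and C: "0 \<le> C" "2 * C \<le> T\<^sup>2"
    and k: "k absolutely_integrable_on {T..}"
    and gk: "\<And>t. T \<le> t \<Longrightarrow> t powr (p / 2 + 1) * norm (g t) \<le> k t"
    and grad: "\<And>t. T \<le> t \<Longrightarrow> (p + 2) * gap t \<le> l * inner (gradient F (x t)) (x t - z)"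
    and damp: "l + 1 - \<alpha> + p / 2 \<le> 0"
    and dist: "\<And>t. T \<le> t \<Longrightarrow> t powr (p - 1) * (l * (l + 1 - \<alpha>) * (p / 2 - l) *
        inner (x t - z) (x t - z)) \<le> C * t powr (- 3) * energy l p t"
    and lower: "\<And>t. T \<le> t \<Longrightarrow> t powr p * inner (mix l t) (mix l t) \<le> 2 * energy l p t"
  shows "\<exists>M. \<forall>t\<ge>T. energy l p t \<le> M"
proof -
  have T0: "0 < T" using T t0 by simp
  define \<kappa> where "\<kappa> = integral {T..} k"
  have k0: "0 \<le> k t" if "T \<le> t" for t
    by (rule order_trans[OF _ gk[OF that]]) simp
  have E0: "0 \<le> energy l p t" if "T \<le> t" for t
    using order_trans[OF _ lower[OF that], of 0] by simp
  have "energy l p t \<le> 2 * energy l p T + 4 * \<kappa>\<^sup>2" if "T \<le> t" for t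
  proof (rule bounded_by_sublinear_feedback[OF _ E0 _ that])
    show "continuous_on {T..t} (energy l p)" for t
      by (rule continuous_on_subset[OF primitive_on_continuous[OF energy_primitive, of t l p]])
        (use T in auto)
    fix t S assume t: "T \<le> t" and S: "\<And>r. T \<le> r \<Longrightarrow> r \<le> t \<Longrightarrow> energy l p r \<le> S"
    have S0: "0 \<le> S" using S[of t] E0[of t] t by simp
    \<comment> \<open>The first summand is \<open>C * S * r powr (- 3)\<close>, written as a
      multiple of the derivative of \<open>r powr (- 2)\<close> so that its integral can be read
      off.\<close>
    have deriv_le: "energy_deriv l p r \<le> - (C * S / 2) * (- 2 * r powr (- 2 - 1)) + sqrt (2 * S) * k r"
      if r: "r \<in> {T..t}" for r
    proof -
      have r': "T \<le> r" "r \<le> t" "0 < r" using r T0 by auto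
      have 1: "r powr (p + 1) * ((p + 2) * gap r - l * inner (gradient F (x r)) (x r - z)) \<le> 0"
        using grad[OF r'(1)] by (intro mult_nonneg_nonpos) auto
      have 2: "r powr (p - 1) * ((l + 1 - \<alpha> + p / 2) * inner (mix l r) (mix l r)) \<le> 0"
        using damp by (intro mult_nonneg_nonpos mult_nonpos_nonneg) auto
      have 3: "r powr (p - 1) * (l * (l + 1 - \<alpha>) * (p / 2 - l) * inner (x r - z) (x r - z))
          \<le> C * r powr (- 3) * S"
        by (rule order_trans[OF dist[OF r'(1)]]) (use S[OF r'(1,2)] C in \<open>auto intro: mult_left_mono\<close>)
      have 4: "r powr (p + 1) * inner (g r) (mix l r) \<le> sqrt (2 * S) * k r"
      proof -
        \<comment> \<open>One factor is the weight on \<open>g\<close> controlled by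
          \<open>k\<close>; the other joins \<open>mix l r\<close>, whose weighted square
          \<open>lower\<close> bounds by the energy.\<close>
        have pp: "r powr (p + 1) = r powr (p / 2 + 1) * r powr (p / 2)"
          by (simp flip: powr_add)
        have "(r powr (p / 2) * norm (mix l r))\<^sup>2 = r powr p * inner (mix l r) (mix l r)"
          by (simp add: power_mult_distrib power2_norm_eq_inner power2_eq_square[of "_ powr _"]
              flip: powr_add)
        also have "\<dots> \<le> 2 * S"
          using lower[OF r'(1)] S[OF r'(1,2)] by simp
        finally have m: "r powr (p / 2) * norm (mix l r) \<le> sqrt (2 * S)"
          by (rule real_le_rsqrt)
        have "r powr (p + 1) * inner (g r) (mix l r) \<le> r powr (p + 1) * (norm (g r) * norm (mix l r))"
          by (intro mult_left_mono norm_cauchy_schwarz) auto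
        also have "\<dots> = (r powr (p / 2) * norm (mix l r)) * (r powr (p / 2 + 1) * norm (g r))"
          by (simp add: pp)
        also have "\<dots> \<le> sqrt (2 * S) * k r"
          using m gk[OF r'(1)] S0 by (intro mult_mono) auto
        finally show ?thesis .
      qed
      show ?thesis
        using 1 2 3 4 unfolding energy_deriv_def by (simp add: distrib_left mult_ac)
    qed
    have kint: "k integrable_on {T..}" using k by (simp add: absolutely_integrable_on_def)
    then have kint': "k integrable_on {T..t}" by (rule integrable_on_subinterval) auto
    have "energy l p t - energy l p T \<le>
        - (C * S / 2) * (t powr (- 2) - T powr (- 2)) + sqrt (2 * S) * integral {T..t} k"
    proof (rule has_integral_le[OF _ _ deriv_le])
      show "(energy_deriv l p has_integral energy l p t - energy l p T) {T..t}"
        by (rule primitive_onD(2)[OF energy_primitive T t order_refl])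
      show "((\<lambda>r. - (C * S / 2) * (- 2 * r powr (- 2 - 1)) + sqrt (2 * S) * k r) has_integral
          - (C * S / 2) * (t powr (- 2) - T powr (- 2)) + sqrt (2 * S) * integral {T..t} k) {T..t}"
        by (intro has_integral_add has_integral_mult_right integrable_integral kint'
            primitive_onD(2)[OF primitive_on_powr[OF T0] order_refl t order_refl])
    qed
    moreover have "integral {T..t} k \<le> \<kappa>"
      unfolding \<kappa>_def using k0 by (intro integral_subset_le kint kint') auto
    then have "sqrt (2 * S) * integral {T..t} k \<le> sqrt (2 * S) * \<kappa>"
      using S0 by (intro mult_left_mono) auto
    \<comment> \<open>The integral of \<open>C * r powr (- 3)\<close> from \<open>T\<close> on is
      \<open>C * T powr (- 2) / 2\<close>, at most 1/4 by the choice of \<open>T\<close>.\<close>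
    moreover have "- (C * S / 2) * (t powr (- 2) - T powr (- 2)) \<le> S / 4"
    proof -
      have "C * T powr (- 2) \<le> 1 / 2"
        using C T0 by (simp add: powr_minus powr_numeral field_simps)
      then have "S * (C * T powr (- 2)) \<le> S * (1 / 2)" using S0 by (intro mult_left_mono)
      moreover have "0 \<le> C * S * t powr (- 2)" using C S0 by simp
      ultimately show ?thesis by (simp add: algebra_simps)
    qed
    ultimately show "energy l p t \<le> energy l p T + S / 4 + sqrt (2 * S) * \<kappa>" by simp
  qed auto
  then show ?thesis by blast
qed

end

text \<open>Changing the second derivative on a null set makes the equation hold at every time.\<close>

lemma is_solution_pointwise:
  fixes F :: "'a::euclidean_space \<Rightarrow> real"
  assumes "is_solution F \<alpha> t0 g x0 v0 x"
  obtains v a where "\<And>t. t0 \<le> t \<Longrightarrow> (x has_vector_derivative v t) (at t within {t0..})"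
    and "\<And>T. primitive_on t0 T v a"
    and "\<And>t. t0 \<le> t \<Longrightarrow> a t + (\<alpha> / t) *\<^sub>R v t + gradient F (x t) = g t"
proof -
  obtain v a where x': "\<And>t. t0 \<le> t \<Longrightarrow> (x has_vector_derivative v t) (at t within {t0..})"
    and a: "\<And>t. t0 \<le> t \<Longrightarrow> a absolutely_integrable_on {t0..t}"
    and v: "\<And>t. t0 \<le> t \<Longrightarrow> v t = v t0 + integral {t0..t} a"
    and ae: "AE t in lebesgue. t0 \<le> t \<longrightarrow> a t + (\<alpha> / t) *\<^sub>R v t + gradient F (x t) = g t"
    using assms unfolding is_solution_def by blast
  from ae obtain N where "N \<in> null_sets lebesgue"
    and N: "\<And>t. t \<notin> N \<Longrightarrow> t0 \<le> t \<Longrightarrow> a t + (\<alpha> / t) *\<^sub>R v t + gradient F (x t) = g t"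
    by (auto elim!: AE_E simp: completion.AE_iff_null_sets)
  then have negl: "negligible N" by (simp add: negligible_iff_null_sets)
  define b where "b t = g t - (\<alpha> / t) *\<^sub>R v t - gradient F (x t)" for t
  have ba: "b t = a t" if "t \<in> {t0..} - N" for t
    using N[of t] that by (simp add: b_def algebra_simps flip: N[of t])
  have "primitive_on t0 T v b" for T
    unfolding primitive_on_def
  proof (intro conjI allI impI)
    show "b absolutely_integrable_on {t0..T}"
    proof (cases "t0 \<le> T")
      case True
      show ?thesis
        by (rule absolutely_integrable_spike[OF a[OF True] negl]) (auto intro: ba)
    qed auto
    fix s t assume st: "t0 \<le> s" "s \<le> t" "t \<le> T"
    have int: "a integrable_on {t0..t}" using a[of t] st by (simp add: absolutely_integrable_on_def)
    have "integral {t0..s} a + integral {s..t} a = integral {t0..t} a"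
      using st int by (intro Henstock_Kurzweil_Integration.integral_combine) auto
    then have "v t - v s = integral {s..t} a"
      using v[of s] v[of t] st by (simp add: algebra_simps)
    moreover have "a integrable_on {s..t}" using int st by (auto intro: integrable_on_subinterval)
    ultimately have "(a has_integral v t - v s) {s..t}" by (simp add: integrable_integral)
    then show "(b has_integral v t - v s) {s..t}"
      by (rule has_integral_spike[OF negl, rotated]) (use st in \<open>auto intro: ba\<close>)
  qed
  with x' show thesis by (rule that) (auto simp: b_def)
qed

section \<open>Rate of convergence\<close>

theorem theorem3p2:
  fixes F :: "real ^ 'n \<Rightarrow> real"
    and g x :: "real \<Rightarrow> real ^ 'n"
    and x0 v0 :: "real ^ 'n"
    and \<alpha> \<gamma> t0 :: real
  assumes "convex_on UNIV F"
    and "\<forall>z. F differentiable (at z)"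
    and "\<exists>!z. z \<in> minimizers F"
    and "\<alpha> > 0" and "t0 > 0"
    and "g absolutely_integrable_on {t0..}"
    and "cauchy_well_posed F \<alpha> t0 g"
    and "is_solution F \<alpha> t0 g x0 v0 x"
    and "1 \<le> \<gamma>" and "\<gamma> \<le> 2"
    and "(\<lambda>t. t powr (\<gamma> * \<alpha> / (\<gamma> + 2)) * norm (g t)) absolutely_integrable_on {t0..}"
    and "cond_H1 \<gamma> F" and "cond_H2 2 F"
    and "\<alpha> > 1 + 2 / \<gamma>"
  shows "(\<lambda>t. F (x t) - minval F) \<in> O(\<lambda>t. t powr (- (2 * \<gamma> * \<alpha> / (\<gamma> + 2))))"
proof -

  \<comment> \<open>The unique minimizer and the exponents\<close>
  obtain z where z: "minimizers F = {z}"
    using assms(3) by (auto simp: set_eq_iff)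
  then have "z \<in> minimizers F" by simp
  then have Fz: "F z \<le> F y" for y
    by (auto simp: minimizers_def is_arg_min_def not_less)
  have min: "F z < F y" if "y \<noteq> z" for y
  proof (rule ccontr)
    assume "\<not> F z < F y"
    then have "y \<in> minimizers F"
      using Fz by (auto simp: minimizers_def is_arg_min_def not_less intro: order_trans)
    with z that show False by simp
  qed
  have minval: "minval F = F z"
    unfolding minval_def using Fz by (intro cInf_eq_minimum) auto
  obtain v a where va: "\<And>t. t0 \<le> t \<Longrightarrow> (x has_vector_derivative v t) (at t within {t0..})"
    "\<And>T. primitive_on t0 T v a"
    "\<And>t. t0 \<le> t \<Longrightarrow> a t + (\<alpha> / t) *\<^sub>R v t + gradient F (x t) = g t"
    using is_solution_pointwise[OF assms(8)] by blast
  interpret damped_trajectory F \<alpha> t0 g x v a z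
    using va assms by unfold_locales auto
  have gap_nonneg: "0 \<le> gap t" for t using Fz by (simp add: gap_def)
  define \<beta> where "\<beta> = \<gamma> * \<alpha> / (\<gamma> + 2)"
  \<comment> \<open>Multiplying the lower bound on \<alpha> by \<gamma> gives
    \<open>\<gamma> * \<alpha> > \<gamma> + 2\<close>.\<close>
  have \<beta>1: "1 < \<beta>" using \<open>1 \<le> \<gamma>\<close> \<open>\<alpha> > 1 + 2 / \<gamma>\<close> by (simp add: \<beta>_def field_simps)
  have \<alpha>2: "2 < \<alpha>"
  proof -
    have "1 \<le> 2 / \<gamma>" using \<open>1 \<le> \<gamma>\<close> \<open>\<gamma> \<le> 2\<close> by (simp add: field_simps)
    then show ?thesis using \<open>\<alpha> > 1 + 2 / \<gamma>\<close> by simp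
  qed
  define k where "k t = t powr \<beta> * norm (g t)" for t
  have k: "k absolutely_integrable_on {T..}" if "t0 \<le> T" for T
    using assms(11) unfolding k_def[abs_def] \<beta>_def
    by (rule set_integrable_subset) (use that in auto)

  text \<open>With \<open>l = \<alpha> - 1\<close> the coefficient \<open>l * (l + 1 - \<alpha>)\<close> vanishes, and plain convexity gives a
    crude decay rate that traps the trajectory near \<open>z\<close>.\<close>
  have "\<exists>M. \<forall>t\<ge>t0. energy (\<alpha> - 1) (min 0 (\<alpha> - 3)) t \<le> M"
  proof (rule energy_bounded[where C = 0])
    define p where "p = min 0 (\<alpha> - 3)"
    \<comment> \<open>The first bound gives \<open>damp\<close> and keeps the source weight
      \<open>p / 2 + 1\<close> below \<beta>; the second gives
      \<open>p + 2 \<le> \<alpha> - 1\<close>, so the gradient inequality of convexity suffices for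
      \<open>grad\<close>.\<close>
    have p: "p \<le> 0" "p \<le> \<alpha> - 3" by (auto simp: p_def)
    show "(\<lambda>t. t0 powr (p / 2 + 1 - \<beta>) * k t) absolutely_integrable_on {t0..}"
      using k by (intro set_integrable_mult_right) auto
    fix t assume t: "t0 \<le> t"
    have "t powr (p / 2 + 1 - \<beta>) \<le> t0 powr (p / 2 + 1 - \<beta>)"
      using t t0 p \<beta>1 by (intro powr_mono2') auto
    then have "t powr (p / 2 + 1 - \<beta>) * t powr \<beta> * norm (g t)
        \<le> t0 powr (p / 2 + 1 - \<beta>) * t powr \<beta> * norm (g t)"
      by (intro mult_right_mono) auto
    then show "t powr (p / 2 + 1) * norm (g t) \<le> t0 powr (p / 2 + 1 - \<beta>) * k t"
      by (simp add: k_def mult.assoc flip: powr_add)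
    have "(p + 2) * gap t \<le> (\<alpha> - 1) * gap t"
      using p gap_nonneg by (intro mult_right_mono) auto
    also have "\<dots> \<le> (\<alpha> - 1) * inner (gradient F (x t)) (x t - z)"
      using \<alpha>2 assms(2) unfolding gap_def
      by (intro mult_left_mono convex_on_gradient_le assms(1)) auto
    finally show "(p + 2) * gap t \<le> (\<alpha> - 1) * inner (gradient F (x t)) (x t - z)" .
    show "t powr p * inner (mix (\<alpha> - 1) t) (mix (\<alpha> - 1) t) \<le> 2 * energy (\<alpha> - 1) p t"
      using gap_nonneg by (simp add: energy_def distrib_left)
  qed auto
  then obtain M where M: "\<And>t. t0 \<le> t \<Longrightarrow> energy (\<alpha> - 1) (min 0 (\<alpha> - 3)) t \<le> M" by blast

  \<comment> \<open>Convergence of the trajectory to the minimizer\<close>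
  define q where "q = min 0 (\<alpha> - 3) + 2"
  have q: "0 < q" using \<alpha>2 by (auto simp: q_def)
  have gap_le: "gap t \<le> M * t powr (- q)" if "t0 \<le> t" for t
  proof -
    have "t powr q * gap t \<le> M"
      by (intro order_trans[OF _ M[OF that]]) (simp add: energy_def q_def)
    then show ?thesis using that t0 by (simp add: powr_minus field_simps)
  qed
  have "((\<lambda>t. M * t powr (- q)) \<longlongrightarrow> M * 0) at_top"
    using q by (intro tendsto_intros tendsto_neg_powr filterlim_ident) auto
  then have majorant_small: "eventually (\<lambda>t. M * t powr (- q) < m) at_top" if "0 < m" for m
    using that by (intro order_tendstoD(2)) auto
  have gap_small: "eventually (\<lambda>t. gap t < m) at_top" if "0 < m" for m
    using majorant_small[OF that] eventually_ge_at_top[of t0]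
    by eventually_elim (auto intro: order_le_less_trans[OF gap_le])
  have near: "eventually (\<lambda>t. x t \<in> ball z \<delta>) at_top" if "0 < \<delta>" for \<delta>
  proof -
    obtain m where "0 < m" "\<And>y. F y - F z < m \<Longrightarrow> dist z y < \<delta>"
      using convex_on_near_unique_minimizer[OF assms(1) min \<open>0 < \<delta>\<close>] by blast
    then show ?thesis
      using gap_small[of m] by (auto simp: gap_def elim!: eventually_mono)
  qed

  \<comment> \<open>The local conditions and the sharp rate\<close>
  obtain \<eta> where \<eta>: "0 < \<eta>" "\<And>y. y \<in> ball z \<eta> \<Longrightarrow> F y - F z \<le> 1 / \<gamma> * inner (gradient F y) (y - z)"
    using assms(12) unfolding cond_H1_def z minval by auto
  obtain K \<epsilon> where K: "0 < K" and \<epsilon>: "0 < \<epsilon>"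
    "\<And>y. y \<in> ball z \<epsilon> \<Longrightarrow> K * dist y z powr 2 \<le> F y - F z"
    using assms(13) unfolding cond_H2_def z minval by auto
  text \<open>This \<open>l\<close> and \<open>p\<close> make the coefficients of \<open>gap\<close> and of \<open>inner (mix l t) (mix l t)\<close> in the
    derivative of the energy vanish.\<close>
  define l where "l = 2 * \<alpha> / (\<gamma> + 2)"
  define p where "p = l * \<gamma> - 2"
  define \<xi> where "\<xi> = l * (l + 1 - \<alpha>)"
  \<comment> \<open>The quadratic growth turns the remaining distance term into at most
    \<open>C / 2 * gap t\<close>; the 2 is there because only half of the weighted gap is available
    as a lower bound for the energy.\<close>
  define C where "C = 2 * \<bar>\<xi> * (p / 2 - l)\<bar> / K"
  \<comment> \<open>The source weight needed by the energy is exactly the one assumed integrable,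
    and \<open>p + 2\<close> is the claimed rate.\<close>
  have p: "p / 2 + 1 = \<beta>" "p + 2 = 2 * \<gamma> * \<alpha> / (\<gamma> + 2)"
    using \<open>1 \<le> \<gamma>\<close> by (auto simp: p_def l_def \<beta>_def field_simps)
  have damp: "l + 1 - \<alpha> + p / 2 = 0"
    using \<open>1 \<le> \<gamma>\<close> by (simp add: p_def l_def field_simps)
  have l0: "0 < l" using \<open>1 \<le> \<gamma>\<close> \<open>\<alpha> > 0\<close> by (simp add: l_def)
  \<comment> \<open>Beyond 1, \<open>t\<close> is at most its square. The entry with
    \<open>C\<close> serves the smallness condition of \<open>energy_bounded\<close>, and the last
    one lets the gap term dominate the distance term.\<close>
  define R where "R = Max {t0, 1, 2 * C, \<bar>\<xi>\<bar> / K}"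
  have R: "t0 \<le> R" "1 \<le> R" "2 * C \<le> R" "\<bar>\<xi>\<bar> / K \<le> R" by (auto simp: R_def)
  have "eventually (\<lambda>t. x t \<in> ball z \<eta> \<and> x t \<in> ball z \<epsilon>) at_top"
    using near \<eta>(1) \<epsilon>(1) by (auto intro: eventually_conj)
  then obtain T where T: "R \<le> T" "\<And>t. T \<le> t \<Longrightarrow> x t \<in> ball z \<eta>" "\<And>t. T \<le> t \<Longrightarrow> x t \<in> ball z \<epsilon>"
    unfolding eventually_at_top_linorder by (metis linorder_le_cases order_trans)
  have sq: "s \<le> t\<^sup>2" if "s \<le> R" "T \<le> t" for s t
  proof -
    have "1 \<le> t" "s \<le> t" using that T(1) R(2) by auto
    then have "t * 1 \<le> t * t" by (intro mult_left_mono) auto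
    then show ?thesis using \<open>s \<le> t\<close> by (simp add: power2_eq_square)
  qed
  have dist_le: "K * inner (x t - z) (x t - z) \<le> gap t" if "T \<le> t" for t
    using \<epsilon>(2)[OF T(3)[OF that]]
    by (simp add: gap_def dist_norm power2_norm_eq_inner)
  \<comment> \<open>The coefficient \<xi> is negative. For large \<open>t\<close>, half of the gap
    term compensates the distance term; the other half is kept for the rate.\<close>
  have energy_ge: "t powr (p + 2) * gap t / 2 + t powr p * (inner (mix l t) (mix l t) / 2) \<le> energy l p t"
    if t: "T \<le> t" for t
  proof -
    define D where "D = inner (x t - z) (x t - z)"
    have "0 < t" using t T(1) R(2) by simp
    have "\<bar>\<xi>\<bar> / K * (K * D) \<le> t\<^sup>2 * gap t"
      using sq[OF R(4) t] dist_le[OF t] K by (intro mult_mono) (auto simp: D_def)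
    then have "\<bar>\<xi>\<bar> * D \<le> t\<^sup>2 * gap t" using K by simp
    moreover have "- \<xi> * D \<le> \<bar>\<xi>\<bar> * D"
      by (intro mult_right_mono) (auto simp: D_def)
    ultimately have "0 \<le> t\<^sup>2 * gap t + \<xi> * D" by simp
    then have "0 \<le> t powr p * (t\<^sup>2 * gap t + \<xi> * D)" by (intro mult_nonneg_nonneg) auto
    moreover have "t powr (p + 2) = t powr p * t\<^sup>2"
      using \<open>0 < t\<close> by (simp add: powr_add powr_numeral)
    moreover have "energy l p t =
        t powr (p + 2) * gap t + t powr p * (inner (mix l t) (mix l t) / 2 + \<xi> / 2 * D)"
      by (simp only: energy_def \<xi>_def D_def)
    ultimately show ?thesis by (simp add: algebra_simps)
  qed
  have "\<exists>M. \<forall>t\<ge>T. energy l p t \<le> M"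
  proof (rule energy_bounded[where C = C and k = k])
    show "t0 \<le> T" "k absolutely_integrable_on {T..}" using R T(1) k by auto
    show "0 \<le> C" using K by (simp add: C_def)
    show "2 * C \<le> T\<^sup>2" using sq R(3) by blast
    show "l + 1 - \<alpha> + p / 2 \<le> 0" using damp by simp
    fix t assume t: "T \<le> t"
    then have "0 < t" using T(1) R(2) by simp
    show "t powr (p / 2 + 1) * norm (g t) \<le> k t" by (simp add: k_def p(1))
    have "\<gamma> * gap t \<le> inner (gradient F (x t)) (x t - z)"
      using \<eta>(2)[OF T(2)[OF t]] \<open>1 \<le> \<gamma>\<close> by (simp add: gap_def field_simps)
    then have "l * (\<gamma> * gap t) \<le> l * inner (gradient F (x t)) (x t - z)"
      using l0 by (intro mult_left_mono) auto
    then show "(p + 2) * gap t \<le> l * inner (gradient F (x t)) (x t - z)"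
      by (simp add: p_def mult.assoc)
    have mm: "0 \<le> t powr p * (inner (mix l t) (mix l t) / 2)" by simp
    have gg: "0 \<le> t powr (p + 2) * gap t" using gap_nonneg by simp
    show "t powr p * inner (mix l t) (mix l t) \<le> 2 * energy l p t"
      using energy_ge[OF t] gg by simp
    define D where "D = inner (x t - z) (x t - z)"
    have "\<xi> * (p / 2 - l) * D \<le> \<bar>\<xi> * (p / 2 - l)\<bar> * D"
      by (intro mult_right_mono) (auto simp: D_def)
    also have "\<dots> = C / 2 * (K * D)" using K by (simp add: C_def)
    also have "\<dots> \<le> C / 2 * gap t"
      using dist_le[OF t] K by (intro mult_left_mono) (auto simp: D_def C_def)
    finally have "t powr (p - 1) * (\<xi> * (p / 2 - l) * D) \<le> t powr (p - 1) * (C / 2 * gap t)"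
      by (intro mult_left_mono) auto
    \<comment> \<open>The distance term carries three powers of \<open>t\<close> less than the gap
      term, which yields the integrable factor in the feedback.\<close>
    also have "t powr (p - 1) = t powr (-3) * t powr (p + 2)"
      by (simp flip: powr_add)
    also have "t powr (-3) * t powr (p + 2) * (C / 2 * gap t)
        = C * t powr (-3) * (t powr (p + 2) * gap t / 2)" by simp
    also have "\<dots> \<le> C * t powr (-3) * energy l p t"
    proof (rule mult_left_mono)
      show "t powr (p + 2) * gap t / 2 \<le> energy l p t" using energy_ge[OF t] mm by linarith
      show "0 \<le> C * t powr (-3)" using K by (simp add: C_def)
    qed
    finally show "t powr (p - 1) * (l * (l + 1 - \<alpha>) * (p / 2 - l) * inner (x t - z) (x t - z))
        \<le> C * t powr (- 3) * energy l p t"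
      by (simp add: \<xi>_def D_def powr_add[symmetric])
  qed
  then obtain M' where M': "\<And>t. T \<le> t \<Longrightarrow> energy l p t \<le> M'" by blast
  have "norm (F (x t) - minval F) \<le> 2 * M' * norm (t powr (- (p + 2)))" if t: "T \<le> t" for t
  proof -
    have "0 < t" using t T(1) R(2) by simp
    have "0 \<le> t powr p * (inner (mix l t) (mix l t) / 2)" by simp
    then have "t powr (p + 2) * gap t \<le> 2 * M'" using energy_ge[OF t] M'[OF t] by linarith
    then have "gap t \<le> 2 * M' * t powr (- (p + 2))"
      using \<open>0 < t\<close> unfolding powr_minus by (simp add: field_simps)
    then show ?thesis using gap_nonneg[of t] by (simp add: minval gap_def)
  qed
  then have "(\<lambda>t. F (x t) - minval F) \<in> O(\<lambda>t. t powr (- (p + 2)))"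
    by (intro bigoI) (auto intro: eventually_mono[OF eventually_ge_at_top[of T]])
  then show ?thesis by (simp add: p(2))
qed

end
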